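(* Let $m\geq 1$, $n\geq 2$ and $i_1,\dots,i_m\geq 0$ be integers such that $|i|:=i_1+\dots+i_m\leq n$. Then for any positive semi-definite symmetric real $n\times n$ matrices $A,B_1,\dots,B_m,M_1,\dots,M_{n-|i|}$, $$\frac{n!}{i_1!\cdots i_m!(n-|i|)!}\det(A)^{m}\,D(B_1[i_1],\dots,B_m[i_m],M_1,\dots,M_{n-|i|})\leq \binom{n}{|i|}D(M_1,\dots,M_{n-|i|},A[|i|])\prod_{k=1}^m \binom{n}{i_k}D(B_k[i_k],A[n-i_k]).$$
   Context: $D(C_1,\dots,C_n)$ denotes the mixed discriminant of $n$ positive semi-definite symmetric real $n\times n$ matrices: it is the symmetric multilinear form determined by the polarization formula $D(C_1,\dots,C_n)=\frac{1}{n!}\sum_{\sigma\in S_n}\det\left(C_{\sigma(1)}^1,\dots,C_{\sigma(n)}^n\right)$, where $C_i^j$ is the $j$-th column of $C_i$. Equivalently, for $t_1,\dots,t_m\ge 0$, $\det(t_1M_1+\cdots+t_mM_m)=\sum_{i_1+\cdots+i_m=n}\frac{n!}{i_1!\cdots i_m!}D(M_1[i_1],\dots,M_m[i_m])\,t_1^{i_1}\cdots t_m^{i_m}$. The notation $M[i]$ means that the matrix $M$ is repeated $i$ times. *)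

theory Defs
  imports "Jordan_Normal_Form.Determinant"
begin

definition symmetric_psd :: "nat \<Rightarrow> real mat \<Rightarrow> bool" where
  "symmetric_psd n A \<longleftrightarrow>
     A \<in> carrier_mat n n \<and> A\<^sup>T = A \<and> (\<forall>x \<in> carrier_vec n. 0 \<le> x \<bullet> (A *\<^sub>v x))"

(* The entries of the list are numbered from 0: Cs is meant to have length n and to consist of
   n x n matrices, and column j of the matrix under the determinant is column j of Cs ! \<sigma> j. *)
definition mixed_discriminant :: "nat \<Rightarrow> real mat list \<Rightarrow> real" where
  "mixed_discriminant n Cs =
     1 / fact n *
     (\<Sum>\<sigma> | \<sigma> permutes {0..<n}. det (mat_of_cols n (map (\<lambda>j. col (Cs ! \<sigma> j) j) [0..<n])))"

end

theory Submission
  imports Defs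
begin

text \<open>Write the positive semi-definite matrices as Gram matrices \<open>X\<^sub>j * X\<^sub>j\<^sup>T\<close>. By multilinearity,
  \<open>n!\<close> times the mixed discriminant is then the sum, over all choices of one column from each \<open>X\<^sub>j\<close>,
  of the squared determinant of the chosen columns. If \<open>A\<close> is singular, the claim reduces to
  nonnegativity of mixed discriminants; otherwise a change of basis turns \<open>A\<close> into the identity. All
  numerical factors now cancel, and the claim follows summand by summand from Fischer's inequality
  for Gram determinants: the squared determinant of a matrix whose columns are partitioned into
  blocks is at most the product of the squared norms of the exterior products of the blocks. This
  holds because the distance of a vector from a span decreases when the span grows.\<close>

subsection \<open>Determinants as functions of the columns\<close>

text \<open>Columns are functions on all naturals, so that replacing a column is a plain function
  update; only indices below \<open>n\<close> influence the value.\<close>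

definition cdet :: "nat \<Rightarrow> (nat \<Rightarrow> nat \<Rightarrow> real) \<Rightarrow> real" where
  "cdet n x = det (mat n n (\<lambda>(r, j). x j r))"

lemma cdet_leibniz:
  "cdet n x = (\<Sum>p | p permutes {..<n}. of_int (sign p) * (\<Prod>j<n. x j (p j)))"
proof -
  have "(\<Prod>j<n. mat n n (\<lambda>(r, j). x j r) $$ (p j, j)) = (\<Prod>j<n. x j (p j))"
    if "p permutes {..<n}" for p
    using permutes_in_image[OF that] by (intro prod.cong) auto
  then show ?thesis
    unfolding cdet_def by (subst det_col[of _ n]) (auto simp: atLeast0LessThan)
qed

lemma cdet_cong:
  assumes "\<And>j r. j < n \<Longrightarrow> r < n \<Longrightarrow> x j r = y j r"
  shows "cdet n x = cdet n y"
  unfolding cdet_def by (rule arg_cong[of _ _ det], rule eq_matI) (auto simp: assms)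

text \<open>Laplace expansion along column \<open>p\<close>. The cofactors do not see that column,
  so they may be taken from the matrix before the update, which makes linearity in \<open>u\<close>
  evident.\<close>

lemma cdet_cofactor:
  assumes "p < n"
  shows "cdet n (x(p := u)) = (\<Sum>r<n. u r * cofactor (mat n n (\<lambda>(r, j). x j r)) r p)"
proof -
  have del: "mat_delete (mat n n (\<lambda>(r, j). (x(p := u)) j r)) r p = mat_delete (mat n n (\<lambda>(r, j). x j r)) r p"
    for r unfolding mat_delete_def by (rule eq_matI) auto
  show ?thesis unfolding cdet_def
    by (subst laplace_expansion_column[of _ n p]) (use assms in \<open>simp_all add: cofactor_def del del: fun_upd_apply, simp\<close>)
qed

lemma cdet_linear:
  assumes "p < n"
  shows "cdet n (x(p := (\<lambda>r. \<Sum>a\<in>I. c a * v a r))) = (\<Sum>a\<in>I. c a * cdet n (x(p := v a)))"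
  unfolding cdet_cofactor[OF assms] sum_distrib_right sum_distrib_left
  by (subst sum.swap) (simp add: mult.assoc)

lemma cdet_minus:
  assumes "p < n"
  shows "cdet n (x(p := (\<lambda>r. v r - w r))) = cdet n (x(p := v)) - cdet n (x(p := w))"
  unfolding cdet_cofactor[OF assms] by (simp add: left_diff_distrib sum_subtractf)

lemma cdet_eq_0:
  assumes "i < n" "j < n" "i \<noteq> j" "x i = x j"
  shows "cdet n x = 0"
  unfolding cdet_def
  by (rule det_identical_columns[of _ n i j]) (use assms in \<open>auto intro!: eq_vecI\<close>)

text \<open>Cramer's rule in the division-free form \<open>X * adj X * u = det X * u\<close>, hence
  valid for dependent columns as well. By cofactor expansion, entry \<open>p\<close> of
  \<open>adj X * u\<close> is the determinant with column \<open>p\<close> replaced by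
  \<open>u\<close>.\<close>

lemma cdet_cramer:
  assumes "r < n"
  shows "(\<Sum>p<n. cdet n (x(p := u)) * x p r) = cdet n x * u r"
proof -
  let ?A = "mat n n (\<lambda>(r, j). x j r)"
  have "(\<Sum>p<n. x p r * cofactor ?A s p) = cdet n x * of_bool (r = s)" if "s < n" for s
  proof -
    have "(\<Sum>p<n. x p r * cofactor ?A s p) = (?A * adj_mat ?A) $$ (r, s)"
      using assms that by (auto simp: scalar_prod_def adj_mat_def atLeast0LessThan intro!: sum.cong)
    also have "\<dots> = (cdet n x \<cdot>\<^sub>m 1\<^sub>m n) $$ (r, s)"
      unfolding cdet_def by (subst adj_mat(2)[of _ n]) auto
    finally show ?thesis using assms that by simp
  qed
  then have "(\<Sum>s<n. u s * (\<Sum>p<n. x p r * cofactor ?A s p)) = (\<Sum>s<n. u s * (cdet n x * of_bool (r = s)))"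
    by simp
  also have "\<dots> = cdet n x * u r"
    using assms by (subst sum.remove[of _ r]) (auto intro!: sum.neutral)
  also have "(\<Sum>s<n. u s * (\<Sum>p<n. x p r * cofactor ?A s p)) = (\<Sum>p<n. cdet n (x(p := u)) * x p r)"
    by (simp add: cdet_cofactor sum_distrib_left sum_distrib_right mult_ac) (rule sum.swap)
  finally show ?thesis .
qed

lemma cdet_matrix_mult:
  assumes "L \<in> carrier_mat n n"
  shows "cdet n (\<lambda>j r. \<Sum>a<n. L $$ (r, a) * x j a) = det L * cdet n x"
  unfolding cdet_def
  by (subst det_mult[OF assms, symmetric])
    (use assms in \<open>auto intro!: arg_cong[of _ _ det] eq_matI simp: scalar_prod_def atLeast0LessThan\<close>)

lemma cdet_permute:
  assumes "\<pi> permutes {..<n}"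
  shows "cdet n (\<lambda>j. x (\<pi> j)) = of_int (sign \<pi>) * cdet n x"
proof -
  have "cdet n (\<lambda>j. x (\<pi> j)) = (\<Sum>p | p permutes {..<n}. of_int (sign (p \<circ> \<pi>)) * (\<Prod>j<n. x (\<pi> j) ((p \<circ> \<pi>) j)))"
    unfolding cdet_leibniz
    by (subst sum_permutations_compose_right[OF assms]) simp
  also have "\<dots> = (\<Sum>p | p permutes {..<n}. of_int (sign \<pi>) * (of_int (sign p) * (\<Prod>j<n. x j (p j))))"
  proof (rule sum.cong[OF refl], clarify)
    fix p assume p: "p permutes {..<n}"
    have "(\<Prod>j<n. x (\<pi> j) ((p \<circ> \<pi>) j)) = (\<Prod>j<n. x j (p j))"
      using prod.permute[OF assms, of "\<lambda>j. x j (p j)"] by (simp add: o_def)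
    moreover have "sign (p \<circ> \<pi>) = sign p * sign \<pi>"
      by (rule sign_compose) (use p assms in \<open>auto intro: permutation_permutes[THEN iffD2]\<close>)
    ultimately show "of_int (sign (p \<circ> \<pi>)) * (\<Prod>j<n. x (\<pi> j) ((p \<circ> \<pi>) j)) =
       of_int (sign \<pi>) * (of_int (sign p) * (\<Prod>j<n. x j (p j)))" by simp
  qed
  finally show ?thesis by (simp add: cdet_leibniz sum_distrib_left)
qed

subsection \<open>Mixed discriminants of Gram matrices\<close>

lemma mixed_discriminant_leibniz:
  assumes "\<And>k. k < n \<Longrightarrow> Cs ! k \<in> carrier_mat n n"
  shows "fact n * mixed_discriminant n Cs =
    (\<Sum>\<sigma> | \<sigma> permutes {..<n}. \<Sum>p | p permutes {..<n}.
       of_int (sign p) * (\<Prod>j<n. (Cs ! \<sigma> j) $$ (p j, j)))"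
proof -
  have "det (mat_of_cols n (map (\<lambda>j. col (Cs ! \<sigma> j) j) [0..<n])) = cdet n (\<lambda>j r. (Cs ! \<sigma> j) $$ (r, j))"
    if "\<sigma> permutes {..<n}" for \<sigma>
  proof -
    have "Cs ! \<sigma> j \<in> carrier_mat n n" if "j < n" for j
      using that permutes_in_image[OF \<open>\<sigma> permutes _\<close>, of j] assms by auto
    then show ?thesis unfolding cdet_def
      by (intro arg_cong[of _ _ det] eq_matI) (force simp: mat_of_cols_def)+
  qed
  then show ?thesis by (simp add: mixed_discriminant_def atLeast0LessThan cdet_leibniz)
qed

text \<open>The sum runs over all permutations, so a rearrangement of the list is absorbed by
  composing with it. This later allows the matrices to be listed in whatever order suits the
  argument.\<close>

lemma mixed_discriminant_mset:
  assumes "mset Cs = mset Ds" "length Ds = n"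
  shows "mixed_discriminant n Cs = mixed_discriminant n Ds"
proof -
  obtain \<pi> where \<pi>: "\<pi> permutes {..<n}" "permute_list \<pi> Ds = Cs"
    using mset_eq_permutation[OF assms(1)] assms(2) by auto
  let ?d = "\<lambda>Cs \<sigma>. det (mat_of_cols n (map (\<lambda>j. col (Cs ! \<sigma> j) j) [0..<n]))"
  have "?d Cs \<sigma> = ?d Ds (\<pi> \<circ> \<sigma>)" if "\<sigma> permutes {0..<n}" for \<sigma>
  proof -
    have "Cs ! \<sigma> j = Ds ! \<pi> (\<sigma> j)" if "j < n" for j
      using permutes_in_image[OF \<open>\<sigma> permutes _\<close>, of j] \<pi> that assms(2)
        permute_list_nth[of \<pi> Ds "\<sigma> j"] by auto
    then show ?thesis by (intro arg_cong[of _ _ det] arg_cong[of _ _ "mat_of_cols n"]) auto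
  qed
  then have "(\<Sum>\<sigma> | \<sigma> permutes {0..<n}. ?d Cs \<sigma>) = (\<Sum>\<sigma> | \<sigma> permutes {0..<n}. ?d Ds (\<pi> \<circ> \<sigma>))"
    by (intro sum.cong) auto
  also have "\<dots> = (\<Sum>\<sigma> | \<sigma> permutes {0..<n}. ?d Ds \<sigma>)"
    using \<pi>(1) by (intro setum_permutations_compose_left[symmetric]) (simp add: atLeast0LessThan)
  finally show ?thesis by (simp only: mixed_discriminant_def)
qed

text \<open>Expanding every Gram entry turns the double sum over permutations into a sum over
  \<open>f\<close>, and for fixed \<open>f\<close> the two permutations separate into two copies of
  the same Leibniz sum.\<close>

lemma mixed_discriminant_gram:
  assumes "\<And>k. k < n \<Longrightarrow> Cs ! k \<in> carrier_mat n n"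
    and "\<And>k r c. k < n \<Longrightarrow> r < n \<Longrightarrow> c < n \<Longrightarrow> (Cs ! k) $$ (r, c) = (\<Sum>a<n. y k a r * y k a c)"
  shows "fact n * mixed_discriminant n Cs =
    (\<Sum>f \<in> {..<n} \<rightarrow>\<^sub>E {..<n}. (cdet n (\<lambda>k. y k (f k)))\<^sup>2)"
proof -
  let ?P = "{p. p permutes {..<n}}"
  let ?F = "{..<n} \<rightarrow>\<^sub>E {..<n}"
  \<comment> \<open>Summing over inverses makes \<open>\<tau> i\<close> the column supplied by
    matrix \<open>i\<close>.\<close>
  have "fact n * mixed_discriminant n Cs =
    (\<Sum>\<tau>\<in>?P. \<Sum>p\<in>?P. of_int (sign p) * (\<Prod>j<n. (Cs ! Hilbert_Choice.inv \<tau> j) $$ (p j, j)))"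
    by (subst mixed_discriminant_leibniz) (use assms(1) in \<open>auto intro: sum_permutations_inverse\<close>)
  also have "\<dots> = (\<Sum>\<tau>\<in>?P. \<Sum>q\<in>?P. \<Sum>f\<in>?F.
      (of_int (sign \<tau>) * (\<Prod>i<n. y i (f i) (\<tau> i))) * (of_int (sign q) * (\<Prod>i<n. y i (f i) (q i))))"
  proof (rule sum.cong[OF refl], clarify)
    fix \<tau> assume \<tau>: "\<tau> permutes {..<n}"
    let ?c = "\<lambda>q. of_int (sign \<tau>) * of_int (sign q) * (\<Prod>i<n. (Cs ! i) $$ (q i, \<tau> i)) :: real"
    \<comment> \<open>Indexing the product by matrices instead of columns, matrix \<open>i\<close>
      contributes its entry in row \<open>p (\<tau> i)\<close> and column \<open>\<tau> i\<close>.
      With \<open>q = p \<circ> \<tau>\<close> the sign of \<open>p\<close> becomes the product of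
      the signs of \<open>\<tau>\<close> and \<open>q\<close>.\<close>
    have "(\<Sum>p\<in>?P. of_int (sign p) * (\<Prod>j<n. (Cs ! Hilbert_Choice.inv \<tau> j) $$ (p j, j))) = (\<Sum>p\<in>?P. ?c (p \<circ> \<tau>))"
    proof (rule sum.cong[OF refl], clarify)
      fix p assume p: "p permutes {..<n}"
      have "(\<Prod>j<n. (Cs ! Hilbert_Choice.inv \<tau> j) $$ (p j, j)) = (\<Prod>i<n. (Cs ! i) $$ (p (\<tau> i), \<tau> i))"
        using prod.permute[OF \<tau>, of "\<lambda>j. (Cs ! Hilbert_Choice.inv \<tau> j) $$ (p j, j)"]
        by (simp add: o_def permutes_inverses[OF \<tau>])
      moreover have "sign (p \<circ> \<tau>) = sign p * sign \<tau>"
        by (rule sign_compose) (use p \<tau> in \<open>auto intro: permutation_permutes[THEN iffD2]\<close>)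
      moreover have "(of_int (sign \<tau>) * of_int (sign \<tau>) :: real) = 1"
        by (simp flip: of_int_mult)
      ultimately show "of_int (sign p) * (\<Prod>j<n. (Cs ! Hilbert_Choice.inv \<tau> j) $$ (p j, j)) = ?c (p \<circ> \<tau>)"
        by (simp add: algebra_simps)
    qed
    also have "\<dots> = (\<Sum>q\<in>?P. ?c q)"
      by (rule sum_permutations_compose_right[OF \<tau>, symmetric])
    also have "\<dots> = (\<Sum>q\<in>?P. \<Sum>f\<in>?F.
      (of_int (sign \<tau>) * (\<Prod>i<n. y i (f i) (\<tau> i))) * (of_int (sign q) * (\<Prod>i<n. y i (f i) (q i))))"
    proof (rule sum.cong[OF refl], clarify)
      fix q assume q: "q permutes {..<n}"
      have "(\<Prod>i<n. (Cs ! i) $$ (q i, \<tau> i)) = (\<Prod>i<n. \<Sum>a<n. y i a (q i) * y i a (\<tau> i))"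
        using permutes_in_image[OF \<tau>] permutes_in_image[OF q]
        by (intro prod.cong) (auto simp: assms(2))
      also have "\<dots> = (\<Sum>f\<in>?F. \<Prod>i<n. y i (f i) (q i) * y i (f i) (\<tau> i))"
        by (rule prod_sum_PiE) auto
      finally show "?c q = (\<Sum>f\<in>?F.
      (of_int (sign \<tau>) * (\<Prod>i<n. y i (f i) (\<tau> i))) * (of_int (sign q) * (\<Prod>i<n. y i (f i) (q i))))"
        by (simp add: prod.distrib sum_distrib_left mult_ac)
    qed
    finally show "(\<Sum>p\<in>?P. of_int (sign p) * (\<Prod>j<n. (Cs ! Hilbert_Choice.inv \<tau> j) $$ (p j, j))) =
      (\<Sum>q\<in>?P. \<Sum>f\<in>?F.
      (of_int (sign \<tau>) * (\<Prod>i<n. y i (f i) (\<tau> i))) * (of_int (sign q) * (\<Prod>i<n. y i (f i) (q i))))" .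
  qed
  also have "\<dots> = (\<Sum>f\<in>?F. \<Sum>\<tau>\<in>?P. \<Sum>q\<in>?P.
      (of_int (sign \<tau>) * (\<Prod>i<n. y i (f i) (\<tau> i))) * (of_int (sign q) * (\<Prod>i<n. y i (f i) (q i))))"
    by (simp only: sum.swap[of _ ?P ?F])
  also have "\<dots> = (\<Sum>f\<in>?F. (cdet n (\<lambda>k. y k (f k)))\<^sup>2)"
    by (simp add: cdet_leibniz power2_eq_square sum_product)
  finally show ?thesis .
qed

lemma mixed_discriminant_nonneg:
  assumes "\<And>k. k < n \<Longrightarrow> Cs ! k \<in> carrier_mat n n"
    and "\<And>k r c. k < n \<Longrightarrow> r < n \<Longrightarrow> c < n \<Longrightarrow> (Cs ! k) $$ (r, c) = (\<Sum>a<n. y k a r * y k a c)"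
  shows "0 \<le> mixed_discriminant n Cs"
proof -
  have "0 \<le> fact n * mixed_discriminant n Cs"
    by (subst mixed_discriminant_gram[of n Cs y]) (use assms in \<open>auto intro: sum_nonneg\<close>)
  then show ?thesis
    using mult_le_cancel_left_pos[of "fact n" 0 "mixed_discriminant n Cs"] by simp
qed

subsection \<open>Sums over products of function spaces\<close>

lemma sum_PiE_Un_disjoint:
  fixes F :: "('a \<Rightarrow> 'b) \<Rightarrow> 'c::comm_monoid_add"
  assumes "S \<inter> T = {}"
  shows "(\<Sum>f\<in>Pi\<^sub>E (S \<union> T) A. F f) =
    (\<Sum>f\<in>Pi\<^sub>E S A. \<Sum>g\<in>Pi\<^sub>E T A. F (\<lambda>k. if k \<in> S then f k else g k))"
  unfolding sum.cartesian_product
proof (rule sum.reindex_bij_witness[where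
    i = "\<lambda>(f, g) k. if k \<in> S then f k else g k" and j = "\<lambda>f. (restrict f S, restrict f T)"], goal_cases)
  case (1 f)
  then show ?case by (auto simp: PiE_def extensional_def fun_eq_iff)
next
  case (3 b)
  then show ?case using assms by (auto simp: PiE_def extensional_def fun_eq_iff)
next
  case (5 f)
  then have "(\<lambda>k. if k \<in> S then restrict f S k else restrict f T k) = f"
    by (auto simp: PiE_def extensional_def fun_eq_iff)
  then show ?case by (simp only: case_prod_conv)
next
  case (2 f)
  then show ?case by (auto simp: PiE_def Pi_def)
next
  case (4 b)
  then show ?case by (auto simp: PiE_def Pi_def extensional_def)
qed

lemma sum_PiE_insert:
  fixes F :: "('a \<Rightarrow> 'b) \<Rightarrow> 'c::comm_monoid_add"
  assumes "p \<notin> S"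
  shows "(\<Sum>f\<in>Pi\<^sub>E (insert p S) A. F f) = (\<Sum>f\<in>Pi\<^sub>E S A. \<Sum>a\<in>A p. F (f(p := a)))"
proof -
  have "(\<Sum>f\<in>Pi\<^sub>E (insert p S) A. F f) = (\<Sum>(a, g)\<in>A p \<times> Pi\<^sub>E S A. F (g(p := a)))"
    unfolding PiE_insert_eq
    by (subst sum.reindex[OF inj_combinator[OF assms]]) (simp add: o_def case_prod_unfold)
  also have "\<dots> = (\<Sum>a\<in>A p. \<Sum>g\<in>Pi\<^sub>E S A. F (g(p := a)))"
    by (rule sum.cartesian_product[symmetric])
  finally show ?thesis by (simp only: sum.swap[of _ "Pi\<^sub>E S A" "A p"])
qed

text \<open>A distributive law: a function on a disjoint union is an independent choice on each
  block, and each factor depends only on its own block. It will factor the sum of the block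
  bounds.\<close>

lemma sum_PiE_Union_disjoint:
  fixes \<phi> :: "'k \<Rightarrow> ('a \<Rightarrow> 'b) \<Rightarrow> 'c::comm_semiring_1"
  assumes "finite K" "disjoint_family_on T K"
    and "\<And>k f g. k \<in> K \<Longrightarrow> (\<And>j. j \<in> T k \<Longrightarrow> f j = g j) \<Longrightarrow> \<phi> k f = \<phi> k g"
  shows "(\<Sum>f\<in>Pi\<^sub>E (\<Union>k\<in>K. T k) A. \<Prod>k\<in>K. \<phi> k f) = (\<Prod>k\<in>K. \<Sum>f\<in>Pi\<^sub>E (T k) A. \<phi> k f)"
  using assms
proof (induction K rule: finite_induct)
  case (insert k K)
  let ?U = "\<Union>k\<in>K. T k"
  have disj: "T k \<inter> ?U = {}"
    using insert.prems(1) insert.hyps by (auto simp: disjoint_family_on_def)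
  have "(\<Sum>f\<in>Pi\<^sub>E (\<Union>k\<in>insert k K. T k) A. \<Prod>l\<in>insert k K. \<phi> l f) =
     (\<Sum>f\<in>Pi\<^sub>E (T k) A. \<Sum>g\<in>Pi\<^sub>E ?U A. \<Prod>l\<in>insert k K. \<phi> l (\<lambda>j. if j \<in> T k then f j else g j))"
    by (simp add: sum_PiE_Un_disjoint[OF disj])
  also have "\<dots> = (\<Sum>f\<in>Pi\<^sub>E (T k) A. \<Sum>g\<in>Pi\<^sub>E ?U A. \<phi> k f * (\<Prod>l\<in>K. \<phi> l g))"
  proof (intro sum.cong refl)
    fix f g
    have "\<phi> k (\<lambda>j. if j \<in> T k then f j else g j) = \<phi> k f"
      by (rule insert.prems(2)) auto
    moreover have "\<phi> l (\<lambda>j. if j \<in> T k then f j else g j) = \<phi> l g" if "l \<in> K" for l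
      by (rule insert.prems(2)) (use that disj in auto)
    ultimately show "(\<Prod>l\<in>insert k K. \<phi> l (\<lambda>j. if j \<in> T k then f j else g j)) = \<phi> k f * (\<Prod>l\<in>K. \<phi> l g)"
      using insert.hyps by simp
  qed
  also have "\<dots> = (\<Sum>f\<in>Pi\<^sub>E (T k) A. \<phi> k f) * (\<Sum>g\<in>Pi\<^sub>E ?U A. \<Prod>l\<in>K. \<phi> l g)"
    by (rule sum_product[symmetric])
  also have "(\<Sum>g\<in>Pi\<^sub>E ?U A. \<Prod>l\<in>K. \<phi> l g) = (\<Prod>k\<in>K. \<Sum>f\<in>Pi\<^sub>E (T k) A. \<phi> k f)"
  proof (rule insert.IH)
    show "disjoint_family_on T K"
      by (rule disjoint_family_on_mono[OF _ insert.prems(1)]) auto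
    show "\<phi> l f = \<phi> l g" if "l \<in> K" "\<And>j. j \<in> T l \<Longrightarrow> f j = g j" for l f g
      by (rule insert.prems(2)) (use that in auto)
  qed
  finally show ?case using insert.hyps by (simp only: prod.insert not_False_eq_True)
qed simp

subsection \<open>Fischer's inequality\<close>

definition basis_vec :: "nat \<Rightarrow> nat \<Rightarrow> real" where
  "basis_vec a r = of_bool (r = a)"

definition dot :: "nat \<Rightarrow> (nat \<Rightarrow> real) \<Rightarrow> (nat \<Rightarrow> real) \<Rightarrow> real" where
  "dot n u v = (\<Sum>r<n. u r * v r)"

text \<open>The squared norm of the exterior product of the vectors \<open>x j\<close>, \<open>j \<in> T\<close>: each minor of size
  \<open>card T\<close> arises from \<open>fact (n - card T)\<close> choices of basis vectors in the other columns.\<close>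

definition wedge_sq :: "nat \<Rightarrow> nat set \<Rightarrow> (nat \<Rightarrow> nat \<Rightarrow> real) \<Rightarrow> real" where
  "wedge_sq n T x =
     (\<Sum>g\<in>({..<n} - T) \<rightarrow>\<^sub>E {..<n}. (cdet n (\<lambda>j. if j \<in> T then x j else basis_vec (g j)))\<^sup>2) / fact (n - card T)"

lemma wedge_sq_nonneg: "0 \<le> wedge_sq n T x"
  unfolding wedge_sq_def by (intro divide_nonneg_pos sum_nonneg) auto

lemma wedge_sq_cong:
  assumes "\<And>j. j \<in> T \<Longrightarrow> x j = y j"
  shows "wedge_sq n T x = wedge_sq n T y"
proof -
  have "(\<lambda>j. if j \<in> T then x j else basis_vec (g j)) = (\<lambda>j. if j \<in> T then y j else basis_vec (g j))" for g
    using assms by auto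
  then show ?thesis by (simp only: wedge_sq_def)
qed

lemma wedge_sq_full: "wedge_sq n {..<n} x = (cdet n x)\<^sup>2"
proof -
  have "cdet n (\<lambda>j. if j \<in> {..<n} then x j else basis_vec (g j)) = cdet n x" for g
    by (rule cdet_cong) simp
  then show ?thesis by (simp add: wedge_sq_def del: lessThan_iff)
qed

lemma cdet_basis_expand:
  assumes "p < n"
  shows "cdet n (x(p := u)) = (\<Sum>a<n. u a * cdet n (x(p := basis_vec a)))"
proof -
  have "cdet n (x(p := u)) = cdet n (x(p := (\<lambda>r. \<Sum>a<n. u a * basis_vec a r)))"
    by (rule cdet_cong) (simp add: basis_vec_def)
  then show ?thesis by (simp only: cdet_linear[OF assms])
qed

text \<open>Exchanging columns \<open>p\<close> and \<open>q\<close> changes each determinant at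
  most by a sign, which squaring removes. Hence it is immaterial which free column receives
  \<open>u\<close>.\<close>

lemma wedge_sq_move:
  assumes "T \<subseteq> {..<n}" "p < n" "q < n" "p \<notin> T" "q \<notin> T"
  shows "wedge_sq n (insert p T) (x(p := u)) = wedge_sq n (insert q T) (x(q := u))"
proof -
  let ?\<tau> = "Transposition.transpose p q"
  let ?E = "{..<n}"
  have \<tau>: "?\<tau> permutes {..<n}" using assms by (intro permutes_swap_id) auto
  have fin: "finite T" using assms(1) finite_subset by blast
  have bij: "?\<tau> j \<in> {..<n} - insert p T \<longleftrightarrow> j \<in> {..<n} - insert q T"
            "?\<tau> j \<in> {..<n} - insert q T \<longleftrightarrow> j \<in> {..<n} - insert p T" for j
    using assms by (auto simp: Transposition.transpose_def)
  have "(\<Sum>g\<in>({..<n} - insert p T) \<rightarrow>\<^sub>E ?E. (cdet n (\<lambda>j. if j \<in> insert p T then (x(p := u)) j else basis_vec (g j)))\<^sup>2)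
     = (\<Sum>g\<in>({..<n} - insert q T) \<rightarrow>\<^sub>E ?E. (cdet n (\<lambda>j. if j \<in> insert q T then (x(q := u)) j else basis_vec (g j)))\<^sup>2)"
  proof (rule sum.reindex_bij_witness[where i = "\<lambda>g. g \<circ> ?\<tau>" and j = "\<lambda>g. g \<circ> ?\<tau>"], goal_cases)
    case (2 g) then show ?case using bij by (auto simp: PiE_def extensional_def Pi_def)
  next
    case (4 g) then show ?case using bij by (auto simp: PiE_def extensional_def Pi_def)
  next
    case (5 g)
    have "(\<lambda>j. if j \<in> insert q T then (x(q := u)) j else basis_vec ((g \<circ> ?\<tau>) j)) =
      (\<lambda>j. (\<lambda>j. if j \<in> insert p T then (x(p := u)) j else basis_vec (g j)) (?\<tau> j))"
      using assms by (auto simp: fun_eq_iff Transposition.transpose_def)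
    moreover have "(sign ?\<tau>)\<^sup>2 = (1 :: int)" by (simp add: power2_eq_square)
    ultimately show ?case
      using cdet_permute[OF \<tau>, of "\<lambda>j. if j \<in> insert p T then (x(p := u)) j else basis_vec (g j)"]
      by (simp only: power_mult_distrib) (simp flip: of_int_power)
  qed (simp_all add: o_assoc[symmetric])
  then show ?thesis using assms fin by (simp add: wedge_sq_def)
qed

text \<open>By Cramer's rule, \<open>dot n u u * cdet n z = (\<Sum>p<n. cdet n (z(p := u)) * dot n (z p) u)\<close>, where only the
  columns outside \<open>T\<close> contribute. Multiplied by \<open>cdet n z\<close> and summed over the basis vector in
  column \<open>p\<close>, the \<open>p\<close>-th term becomes \<open>(cdet n (z(p := u)))\<^sup>2\<close>.\<close>

lemma wedge_sq_insert_orthogonal: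
  assumes T: "T \<subseteq> {..<n}" and j: "j < n" "j \<notin> T"
    and orth: "\<And>l. l \<in> T \<Longrightarrow> dot n (x l) u = 0"
  shows "wedge_sq n (insert j T) (x(j := u)) = dot n u u * wedge_sq n T x"
proof -
  let ?S = "{..<n} - T" and ?E = "{..<n}"
  define z where "z g = (\<lambda>k. if k \<in> T then x k else basis_vec (g k))" for g
  have fin: "finite T" using T finite_subset by blast
  have cT: "card T < n"
    using psubset_card_mono[of "{..<n}" T] T j by auto
  have step: "dot n u u * cdet n (z g) = (\<Sum>p\<in>?S. cdet n ((z g)(p := u)) * u (g p))"
    if g: "g \<in> ?S \<rightarrow>\<^sub>E ?E" for g
  proof -
    have "dot n u u * cdet n (z g) = (\<Sum>r<n. u r * (cdet n (z g) * u r))"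
      by (simp add: dot_def sum_distrib_left mult_ac)
    also have "\<dots> = (\<Sum>r<n. u r * (\<Sum>p<n. cdet n ((z g)(p := u)) * z g p r))"
      by (simp add: cdet_cramer)
    also have "\<dots> = (\<Sum>p<n. cdet n ((z g)(p := u)) * dot n (z g p) u)"
      by (simp add: dot_def sum_distrib_left sum_distrib_right mult_ac) (rule sum.swap)
    also have "\<dots> = (\<Sum>p\<in>?S. cdet n ((z g)(p := u)) * u (g p))"
    proof (rule sum.mono_neutral_cong_right, goal_cases)
      case 3 then show ?case by (auto simp: z_def orth)
    next
      case (4 p)
      then have "g p < n" using g by (auto dest: PiE_mem)
      then have "dot n (z g p) u = u (g p)"
        using 4 by (simp add: z_def dot_def basis_vec_def)
      then show ?case by simp
    qed auto
    finally show ?thesis .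
  qed
  have "dot n u u * (\<Sum>g\<in>?S \<rightarrow>\<^sub>E ?E. (cdet n (z g))\<^sup>2) =
    (\<Sum>g\<in>?S \<rightarrow>\<^sub>E ?E. \<Sum>p\<in>?S. cdet n ((z g)(p := u)) * u (g p) * cdet n (z g))"
    by (simp add: sum_distrib_left power2_eq_square mult.assoc[symmetric] step sum_distrib_right)
  also have "\<dots> = (\<Sum>p\<in>?S. \<Sum>g\<in>?S \<rightarrow>\<^sub>E ?E. cdet n ((z g)(p := u)) * u (g p) * cdet n (z g))"
    by (rule sum.swap)
  also have "\<dots> = (\<Sum>p\<in>?S. fact (n - card (insert j T)) * wedge_sq n (insert j T) (x(j := u)))"
  proof (rule sum.cong[OF refl])
    fix p assume p: "p \<in> ?S"
    let ?S' = "{..<n} - insert p T"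
    have ins: "?S = insert p ?S'" using p by auto
    have upd: "z (g(p := a)) = (z g)(p := basis_vec a)" for g a
      using p by (auto simp: z_def fun_eq_iff)
    have "(\<Sum>g\<in>?S \<rightarrow>\<^sub>E ?E. cdet n ((z g)(p := u)) * u (g p) * cdet n (z g)) =
      (\<Sum>g\<in>?S' \<rightarrow>\<^sub>E ?E. \<Sum>a<n. cdet n ((z g)(p := u)) * u a * cdet n ((z g)(p := basis_vec a)))"
      unfolding ins by (subst sum_PiE_insert) (simp_all only: upd fun_upd_same fun_upd_upd, simp)
    also have "\<dots> = (\<Sum>g\<in>?S' \<rightarrow>\<^sub>E ?E. (cdet n ((z g)(p := u)))\<^sup>2)"
    proof (rule sum.cong[OF refl])
      fix g
      have "(\<Sum>a<n. cdet n ((z g)(p := u)) * u a * cdet n ((z g)(p := basis_vec a))) =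
        cdet n ((z g)(p := u)) * (\<Sum>a<n. u a * cdet n ((z g)(p := basis_vec a)))"
        by (simp add: sum_distrib_left mult.assoc)
      also have "\<dots> = (cdet n ((z g)(p := u)))\<^sup>2"
        using p by (simp add: cdet_basis_expand[symmetric] power2_eq_square)
      finally show "(\<Sum>a<n. cdet n ((z g)(p := u)) * u a * cdet n ((z g)(p := basis_vec a))) = \<dots>" .
    qed
    also have "\<dots> = fact (n - card (insert p T)) * wedge_sq n (insert p T) (x(p := u))"
    proof -
      have "(\<lambda>k. if k \<in> insert p T then (x(p := u)) k else basis_vec (g k)) = (z g)(p := u)" for g
        by (auto simp: z_def fun_eq_iff)
      then show ?thesis by (simp only: wedge_sq_def) simp
    qed
    also have "\<dots> = fact (n - card (insert j T)) * wedge_sq n (insert j T) (x(j := u))"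
      using wedge_sq_move[of T n p j x u] p T j fin by simp
    finally show "(\<Sum>g\<in>?S \<rightarrow>\<^sub>E ?E. cdet n ((z g)(p := u)) * u (g p) * cdet n (z g)) = \<dots>" .
  qed
  \<comment> \<open>All terms agree, and there are \<open>n - card T\<close> of them; this is the
    factor by which the two factorials differ.\<close>
  also have "\<dots> = fact (n - card T) * wedge_sq n (insert j T) (x(j := u))"
  proof -
    have "card ?S = n - card T" using T fin by (simp add: card_Diff_subset)
    moreover have "n - card T = Suc (n - card (insert j T))" using cT j fin by simp
    ultimately show ?thesis by (simp add: algebra_simps)
  qed
  also have "(\<Sum>g\<in>?S \<rightarrow>\<^sub>E ?E. (cdet n (z g))\<^sup>2) = fact (n - card T) * wedge_sq n T x"
    by (simp add: wedge_sq_def z_def)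
  finally show ?thesis by (simp add: fun_upd_def)
qed

text \<open>A column operation: each subtracted term gives a determinant with two equal
  columns.\<close>

lemma wedge_sq_column_add:
  assumes T: "T \<subseteq> {..<n}" and j: "j < n" "j \<notin> T"
  shows "wedge_sq n (insert j T) (x(j := (\<lambda>r. v r - (\<Sum>l\<in>T. c l * x l r)))) = wedge_sq n (insert j T) (x(j := v))"
proof -
  have "cdet n (\<lambda>k. if k \<in> insert j T then (x(j := (\<lambda>r. v r - (\<Sum>l\<in>T. c l * x l r)))) k else basis_vec (g k)) =
    cdet n (\<lambda>k. if k \<in> insert j T then (x(j := v)) k else basis_vec (g k))" for g
  proof -
    define z where "z k = (if k \<in> T then x k else basis_vec (g k))" for k
    have upd: "(\<lambda>k. if k \<in> insert j T then (x(j := w)) k else basis_vec (g k)) = z(j := w)" for w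
      using j by (auto simp: z_def fun_eq_iff)
    have "cdet n (z(j := x l)) = 0" if "l \<in> T" for l
      by (rule cdet_eq_0[of j n l]) (use T j that in \<open>auto simp: z_def\<close>)
    then show ?thesis unfolding upd by (simp add: cdet_minus[OF j(1)] cdet_linear[OF j(1)])
  qed
  then show ?thesis unfolding wedge_sq_def by simp
qed

section \<open>Inner products and orthogonal residuals\<close>

lemma dot_commute: "dot n u v = dot n v u"
  by (simp add: dot_def mult.commute)

lemma dot_sum: "dot n (\<lambda>r. \<Sum>l\<in>T. c l * x l r) v = (\<Sum>l\<in>T. c l * dot n (x l) v)"
  unfolding dot_def by (simp add: sum_distrib_left sum_distrib_right mult.assoc) (rule sum.swap)

lemma dot_add: "dot n (\<lambda>r. u r + w r) v = dot n u v + dot n w v"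
  by (simp add: dot_def sum.distrib algebra_simps)

lemma dot_diff: "dot n (\<lambda>r. u r - w r) v = dot n u v - dot n w v"
  by (simp add: dot_def sum_subtractf algebra_simps)

lemma dot_diff_scale_right: "dot n v (\<lambda>r. u r - c * w r) = dot n v u - c * dot n v w"
  by (simp add: dot_def sum_subtractf sum_distrib_left algebra_simps)

lemma dot_self_nonneg: "0 \<le> dot n u u"
  unfolding dot_def by (intro sum_nonneg) auto

lemma dot_self_eq_0: "dot n u u = 0 \<Longrightarrow> dot n v u = 0"
  unfolding dot_def by (subst (asm) sum_nonneg_eq_0_iff) auto

text \<open>A Gram-Schmidt step without any assumption of independence: first make \<open>v\<close>
  and the new vector \<open>x k\<close> orthogonal to the old ones, then remove from the first
  residual its component along the second.\<close>

lemma orthogonal_residual_exists: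
  assumes "finite T"
  shows "\<exists>c. \<forall>l\<in>T. dot n (x l) (\<lambda>r. v r - (\<Sum>l\<in>T. c l * x l r)) = 0"
  using assms
proof (induction T arbitrary: v rule: finite_induct)
  case (insert k T)
  obtain c where c: "\<And>l. l \<in> T \<Longrightarrow> dot n (x l) (\<lambda>r. v r - (\<Sum>l\<in>T. c l * x l r)) = 0"
    using insert.IH by blast
  obtain d where d: "\<And>l. l \<in> T \<Longrightarrow> dot n (x l) (\<lambda>r. x k r - (\<Sum>l\<in>T. d l * x l r)) = 0"
    using insert.IH by blast
  define u where "u = (\<lambda>r. v r - (\<Sum>l\<in>T. c l * x l r))"
  define w where "w = (\<lambda>r. x k r - (\<Sum>l\<in>T. d l * x l r))"
  \<comment> \<open>If \<open>w\<close> has norm 0 then division by zero gives \<open>t = 0\<close>,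
    which is the right value because \<open>u\<close> is then already orthogonal to
    \<open>w\<close>.\<close>
  define t where "t = dot n w u / dot n w w"
  \<comment> \<open>These are the coefficients that appear when \<open>u - t * w\<close> is written
    out in terms of \<open>v\<close> and the vectors \<open>x l\<close>.\<close>
  define b where "b = (\<lambda>l. c l - t * d l)(k := t)"
  have "(\<Sum>l\<in>insert k T. b l * x l r) = (\<Sum>l\<in>T. c l * x l r) + t * w r" for r
  proof -
    have "(\<Sum>l\<in>T. b l * x l r) = (\<Sum>l\<in>T. (c l - t * d l) * x l r)"
      by (rule sum.cong) (use insert.hyps in \<open>auto simp: b_def\<close>)
    then show ?thesis using insert.hyps
      by (simp add: b_def w_def algebra_simps sum_subtractf sum_distrib_left)
  qed
  then have res: "(\<lambda>r. v r - (\<Sum>l\<in>insert k T. b l * x l r)) = (\<lambda>r. u r - t * w r)"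
    by (auto simp: u_def fun_eq_iff)
  have uT: "dot n (x l) u = 0" and wT: "dot n (x l) w = 0" if "l \<in> T" for l
    using c d that by (auto simp: u_def w_def)
  have w0: "dot n w (\<lambda>r. u r - t * w r) = 0"
    unfolding dot_diff_scale_right using dot_self_eq_0[of n w u] by (auto simp: t_def dot_commute)
  have T0: "dot n (x l) (\<lambda>r. u r - t * w r) = 0" if "l \<in> T" for l
    using uT[OF that] wT[OF that] by (simp add: dot_diff_scale_right)
  have xk: "x k = (\<lambda>r. w r + (\<Sum>l\<in>T. d l * x l r))"
    by (simp add: w_def)
  have "dot n (x k) (\<lambda>r. u r - t * w r) = 0"
    by (subst xk, simp only: dot_add dot_sum) (simp add: w0 T0)
  with T0 show ?case by (intro exI[of _ b]) (simp only: res, blast)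
qed simp

text \<open>Pythagoras: \<open>w - u\<close> lies in the span over \<open>S\<close>, to which
  \<open>u\<close> is orthogonal, so \<open>w\<close> can only be longer.\<close>

lemma orthogonal_residual_minimal:
  assumes "\<And>l. l \<in> S \<Longrightarrow> dot n (x l) u = 0"
    and "u = (\<lambda>r. v r - (\<Sum>l\<in>S. c l * x l r))" and "w = (\<lambda>r. v r - (\<Sum>l\<in>T. d l * x l r))"
    and "T \<subseteq> S"
  shows "dot n u u \<le> dot n w w"
proof -
  define e where "e = (\<lambda>r. (\<Sum>l\<in>S. c l * x l r) - (\<Sum>l\<in>T. d l * x l r))"
  have w: "w = (\<lambda>r. u r + e r)" using assms(2,3) by (auto simp: e_def)
  have eu: "dot n e u = 0"
    using assms(1,4) by (auto simp: e_def dot_diff dot_sum intro!: sum.neutral)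
  have "dot n w w = dot n u u + 2 * dot n e u + dot n e e"
    unfolding w by (simp add: dot_def algebra_simps sum.distrib sum_distrib_left)
  then show ?thesis using eu dot_self_nonneg[of n e] by simp
qed

text \<open>Base times height, in squared form: the new vector may be replaced by its component
  orthogonal to the span of the others.\<close>

lemma wedge_sq_insert:
  assumes "T \<subseteq> {..<n}" "j < n" "j \<notin> T"
    and "\<And>l. l \<in> T \<Longrightarrow> dot n (x l) u = 0" "u = (\<lambda>r. x j r - (\<Sum>l\<in>T. c l * x l r))"
  shows "wedge_sq n (insert j T) x = dot n u u * wedge_sq n T x"
  using wedge_sq_insert_orthogonal[OF assms(1-4)] wedge_sq_column_add[OF assms(1-3), of x "x j" c] assms(5)
  by simp

text \<open>The normalisation of \<open>wedge_sq\<close>, obtained without counting permutations: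
  adding the orthonormal standard basis vectors one by one never changes the value, and with all of
  them present it is the squared determinant of the identity.\<close>

lemma wedge_sq_empty: "wedge_sq n {} x = 1"
proof -
  have ind: "wedge_sq n {..<k} basis_vec = wedge_sq n {} basis_vec" if "k \<le> n" for k
    using that
  proof (induction k)
    case (Suc k)
    have "wedge_sq n (insert k {..<k}) basis_vec = dot n (basis_vec k) (basis_vec k) * wedge_sq n {..<k} basis_vec"
      by (rule wedge_sq_insert[where c = "\<lambda>_. 0"]) (use Suc.prems in \<open>auto simp: dot_def basis_vec_def\<close>)
    moreover have "dot n (basis_vec k) (basis_vec k) = 1"
      using Suc.prems by (simp add: dot_def basis_vec_def)
    ultimately show ?case using Suc by (simp add: lessThan_Suc)
  qed simp
  have "cdet n basis_vec = det (1\<^sub>m n :: real mat)"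
    unfolding cdet_def by (rule arg_cong[of _ _ det]) (auto simp: basis_vec_def)
  then have "wedge_sq n {} basis_vec = 1"
    using ind[of n] by (simp add: wedge_sq_full)
  then show ?thesis using wedge_sq_cong[of "{}" x basis_vec n] by simp
qed

text \<open>The vectors of \<open>T\<close> are added one at a time. On the left the height is
  measured from the span over \<open>S \<union> T\<close>, on the right from the smaller span over
  \<open>T\<close>.\<close>

lemma wedge_sq_Un_le:
  assumes "S \<subseteq> {..<n}" "T \<subseteq> {..<n}" "S \<inter> T = {}"
  shows "wedge_sq n (S \<union> T) x \<le> wedge_sq n S x * wedge_sq n T x"
proof -
  have "finite T" using assms finite_subset by blast
  then show ?thesis using assms(2,3)
  proof (induction T rule: finite_induct)
    case (insert j T)
    let ?U = "S \<union> T"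
    have U: "?U \<subseteq> {..<n}" "j < n" "j \<notin> ?U" "T \<subseteq> {..<n}" "j \<notin> T"
      using insert assms(1) by auto
    have fU: "finite ?U" using U finite_subset by blast
    obtain c where c: "\<And>l. l \<in> ?U \<Longrightarrow> dot n (x l) (\<lambda>r. x j r - (\<Sum>l\<in>?U. c l * x l r)) = 0"
      using orthogonal_residual_exists[OF fU] by blast
    obtain d where d: "\<And>l. l \<in> T \<Longrightarrow> dot n (x l) (\<lambda>r. x j r - (\<Sum>l\<in>T. d l * x l r)) = 0"
      using orthogonal_residual_exists[OF insert.hyps(1)] by blast
    let ?u = "\<lambda>r. x j r - (\<Sum>l\<in>?U. c l * x l r)" and ?w = "\<lambda>r. x j r - (\<Sum>l\<in>T. d l * x l r)"
    have "wedge_sq n (S \<union> insert j T) x = dot n ?u ?u * wedge_sq n ?U x"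
      using wedge_sq_insert[OF U(1,2,3) c refl] by simp
    also have "\<dots> \<le> dot n ?w ?w * (wedge_sq n S x * wedge_sq n T x)"
      using orthogonal_residual_minimal[OF c refl refl, of T d] insert
      by (intro mult_mono) (auto simp: dot_self_nonneg wedge_sq_nonneg)
    also have "\<dots> = wedge_sq n S x * wedge_sq n (insert j T) x"
      using wedge_sq_insert[OF U(4,2,5) d refl] by simp
    finally show ?case .
  qed (simp add: wedge_sq_empty)
qed

lemma wedge_sq_Union_le:
  assumes "finite K" "disjoint_family_on T K" "\<And>k. k \<in> K \<Longrightarrow> T k \<subseteq> {..<n}"
  shows "wedge_sq n (\<Union>k\<in>K. T k) x \<le> (\<Prod>k\<in>K. wedge_sq n (T k) x)"
  using assms
proof (induction K rule: finite_induct)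
  case (insert k K)
  have "wedge_sq n (T k \<union> (\<Union>k\<in>K. T k)) x \<le> wedge_sq n (T k) x * wedge_sq n (\<Union>k\<in>K. T k) x"
    by (rule wedge_sq_Un_le) (use insert in \<open>auto simp: disjoint_family_on_def\<close>)
  also have "\<dots> \<le> wedge_sq n (T k) x * (\<Prod>k\<in>K. wedge_sq n (T k) x)"
    using insert by (intro mult_left_mono wedge_sq_nonneg) (auto simp: disjoint_family_on_def)
  finally show ?case using insert.hyps by simp
qed (simp add: wedge_sq_empty)

subsection \<open>Gram representations\<close>

lemma quadratic_form_basis:
  assumes "k < n"
  shows "(\<Sum>i<n. \<Sum>j<n. basis_vec k i * a i j * basis_vec k j) = a k k"
proof -
  have "(\<Sum>j<n. basis_vec k i * a i j * basis_vec k j) = basis_vec k i * a i k" for i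
    using assms by (simp add: basis_vec_def)
  then show ?thesis using assms by (simp add: basis_vec_def)
qed

lemma quadratic_form_shift:
  fixes a :: "nat \<Rightarrow> nat \<Rightarrow> real"
  assumes "k < n" and sym: "\<And>i j. i < n \<Longrightarrow> j < n \<Longrightarrow> a i j = a j i"
  shows "(\<Sum>i<n. \<Sum>j<n. (x i + t * basis_vec k i) * a i j * (x j + t * basis_vec k j)) =
    (\<Sum>i<n. \<Sum>j<n. x i * a i j * x j) + 2 * t * (\<Sum>j<n. a k j * x j) + t\<^sup>2 * a k k"
proof -
  have "(\<Sum>i<n. \<Sum>j<n. (x i + t * basis_vec k i) * a i j * (x j + t * basis_vec k j)) =
    (\<Sum>i<n. \<Sum>j<n. x i * a i j * x j) + t * (\<Sum>i<n. \<Sum>j<n. basis_vec k i * a i j * x j)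
    + t * (\<Sum>i<n. \<Sum>j<n. x i * a i j * basis_vec k j)
    + t\<^sup>2 * (\<Sum>i<n. \<Sum>j<n. basis_vec k i * a i j * basis_vec k j)"
    by (simp add: sum_distrib_left sum.distrib[symmetric] algebra_simps power2_eq_square)
  moreover have "(\<Sum>i<n. \<Sum>j<n. basis_vec k i * a i j * x j) = (\<Sum>j<n. a k j * x j)"
    using assms(1) by (simp add: basis_vec_def sum_distrib_left[symmetric] mult.assoc)
  moreover have "(\<Sum>i<n. \<Sum>j<n. x i * a i j * basis_vec k j) = (\<Sum>j<n. a k j * x j)"
    using assms(1) by (simp add: basis_vec_def sym[of _ k] mult.commute)
  moreover have "(\<Sum>i<n. \<Sum>j<n. basis_vec k i * a i j * basis_vec k j) = a k k"
    by (rule quadratic_form_basis[OF assms(1)])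
  ultimately show ?thesis by simp
qed

text \<open>Symmetric Gaussian elimination from the last index downwards: only the first
  \<open>k\<close> rows may still be nonzero, and each step clears one more row and column at the
  cost of one Gram vector.\<close>

lemma psd_gram_elimination:
  fixes a :: "nat \<Rightarrow> nat \<Rightarrow> real"
  assumes "k \<le> n"
    and "\<And>i j. i < n \<Longrightarrow> j < n \<Longrightarrow> a i j = a j i"
    and "\<And>x. 0 \<le> (\<Sum>i<n. \<Sum>j<n. x i * a i j * x j)"
    and "\<And>i j. i < n \<Longrightarrow> j < n \<Longrightarrow> k \<le> i \<Longrightarrow> a i j = 0"
  shows "\<exists>y. \<forall>i<n. \<forall>j<n. a i j = (\<Sum>l<k. y l i * y l j)"
  using assms
proof (induction k arbitrary: a)
  case (Suc k)
  note sym = Suc.prems(2) and psd = Suc.prems(3) and zero = Suc.prems(4)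
  have k: "k < n" using Suc.prems by simp
  have shift: "(\<Sum>i<n. \<Sum>j<n. (x i + t * basis_vec k i) * a i j * (x j + t * basis_vec k j)) =
    (\<Sum>i<n. \<Sum>j<n. x i * a i j * x j) + 2 * t * (\<Sum>j<n. a k j * x j) + t\<^sup>2 * a k k" for x t
    by (rule quadratic_form_shift[OF k]) (rule sym)
  have akk: "0 \<le> a k k"
    using psd[of "basis_vec k"] quadratic_form_basis[OF k, of a] by simp
  show ?case
  proof (cases "a k k = 0")
    case True
    have "a k j = 0" if j: "j < n" for j
    proof (rule ccontr)
      assume ne: "a k j \<noteq> 0"
      \<comment> \<open>With a zero diagonal entry the form is affine in \<open>t\<close> along
        direction \<open>k\<close>; this value brings it to -1, a contradiction. So the whole row
        vanishes and the zero vector serves as Gram vector.\<close>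
      define t where "t = - (a j j + 1) / (2 * a k j)"
      have "0 \<le> a j j + 2 * t * a k j"
        using psd[of "\<lambda>i. basis_vec j i + t * basis_vec k i"] True j
        unfolding shift quadratic_form_basis[OF j] by (simp add: basis_vec_def)
      also have "\<dots> = -1" using ne by (simp add: t_def field_simps)
      finally show False by simp
    qed
    then have z: "a i j = 0" if "i < n" "j < n" "k \<le> i" for i j
      using that zero[of i j] by (cases "i = k") auto
    have "\<exists>y. \<forall>i<n. \<forall>j<n. a i j = (\<Sum>l<k. y l i * y l j)"
      by (rule Suc.IH) (use Suc.prems(1) sym psd z in auto)
    then obtain y where y: "\<forall>i<n. \<forall>j<n. a i j = (\<Sum>l<k. y l i * y l j)" by blast
    show ?thesis
      by (rule exI[of _ "\<lambda>l i. if l < k then y l i else 0"]) (use y in simp)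
  next
    case False
    then have pos: "0 < a k k" using akk by simp
    \<comment> \<open>The Schur complement of the pivot \<open>a k k\<close>.\<close>
    define b where "b i j = a i j - a k i * a k j / a k k" for i j
    have b_psd: "0 \<le> (\<Sum>i<n. \<Sum>j<n. x i * b i j * x j)" for x
    proof -
      define L where "L = (\<Sum>j<n. a k j * x j)"
      have "(\<Sum>i<n. \<Sum>j<n. x i * (a k i * a k j / a k k) * x j) = L * L / a k k"
        unfolding L_def sum_product by (simp add: sum_divide_distrib mult_ac)
      then have "(\<Sum>i<n. \<Sum>j<n. x i * b i j * x j) = (\<Sum>i<n. \<Sum>j<n. x i * a i j * x j) - L * L / a k k"
        by (simp add: b_def left_diff_distrib right_diff_distrib sum_subtractf)
      \<comment> \<open>Completing the square: the form of \<open>b\<close> at \<open>x\<close> is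
        the form of \<open>a\<close> at \<open>x\<close> shifted along direction \<open>k\<close> by
        the minimising amount \<open>- L / a k k\<close>.\<close>
      also have "\<dots> = (\<Sum>i<n. \<Sum>j<n. x i * a i j * x j) + 2 * (- L / a k k) * L + (- L / a k k)\<^sup>2 * a k k"
        using pos by (simp add: field_simps power2_eq_square)
      also have "\<dots> \<ge> 0"
        using psd[of "\<lambda>i. x i + (- L / a k k) * basis_vec k i"] unfolding shift L_def .
      finally show ?thesis .
    qed
    have b_zero: "b i j = 0" if "i < n" "j < n" "k \<le> i" for i j
    proof (cases "i = k")
      case True
      then show ?thesis using pos by (simp add: b_def)
    next
      case False
      then have "a i j = 0" "a k i = 0"
        using zero[of i j] zero[of i k] sym[of i k] that k by auto
      then show ?thesis by (simp add: b_def)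
    qed
    have b_sym: "b i j = b j i" if "i < n" "j < n" for i j
      using sym[OF that] by (simp add: b_def mult.commute)
    have "\<exists>y. \<forall>i<n. \<forall>j<n. b i j = (\<Sum>l<k. y l i * y l j)"
      by (rule Suc.IH[OF _ b_sym b_psd b_zero]) (use Suc.prems(1) in auto)
    then obtain y where y: "\<forall>i<n. \<forall>j<n. b i j = (\<Sum>l<k. y l i * y l j)" by blast
    define w where "w l i = (if l < k then y l i else a k i / sqrt (a k k))" for l i
    have "a i j = (\<Sum>l<Suc k. w l i * w l j)" if "i < n" "j < n" for i j
    proof -
      have "(\<Sum>l<Suc k. w l i * w l j) = b i j + a k i * a k j / a k k"
        using y that pos by (simp add: w_def)
      then show ?thesis by (simp add: b_def)
    qed
    then show ?thesis by blast
  qed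
qed simp

lemma symmetric_psd_gram:
  assumes "symmetric_psd n A"
  obtains y where "\<And>r c. r < n \<Longrightarrow> c < n \<Longrightarrow> A $$ (r, c) = (\<Sum>l<n. y l r * y l c)"
proof -
  have A: "A \<in> carrier_mat n n" "A\<^sup>T = A" using assms by (auto simp: symmetric_psd_def)
  have "\<exists>y. \<forall>i<n. \<forall>j<n. A $$ (i, j) = (\<Sum>l<n. y l i * y l j)"
  proof (rule psd_gram_elimination[OF order.refl])
    show "A $$ (i, j) = A $$ (j, i)" if "i < n" "j < n" for i j
      using that A index_transpose_mat(1)[of j A i] by auto
    show "0 \<le> (\<Sum>i<n. \<Sum>j<n. x i * A $$ (i, j) * x j)" for x
    proof -
      have "0 \<le> vec n x \<bullet> (A *\<^sub>v vec n x)" using assms by (simp add: symmetric_psd_def)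
      also have "\<dots> = (\<Sum>i<n. \<Sum>j<n. x i * A $$ (i, j) * x j)"
        using A by (simp add: scalar_prod_def atLeast0LessThan sum_distrib_left mult.assoc)
      finally show ?thesis .
    qed
  qed simp
  then show ?thesis using that by blast
qed

lemma mixed_discriminant_psd_nonneg:
  assumes "length Cs = n" "\<And>C. C \<in> set Cs \<Longrightarrow> symmetric_psd n C"
  shows "0 \<le> mixed_discriminant n Cs"
proof -
  have "\<exists>y. \<forall>r<n. \<forall>c<n. (Cs ! k) $$ (r, c) = (\<Sum>a<n. y a r * y a c)" if "k < n" for k
    using symmetric_psd_gram[OF assms(2), of "Cs ! k"] that assms(1) by (metis nth_mem)
  then obtain y where "\<And>k r c. k < n \<Longrightarrow> r < n \<Longrightarrow> c < n \<Longrightarrow> (Cs ! k) $$ (r, c) = (\<Sum>a<n. y k a r * y k a c)"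
    by metis
  then show ?thesis
    by (intro mixed_discriminant_nonneg[of n Cs y]) (use assms in \<open>auto simp: symmetric_psd_def\<close>)
qed

section \<open>Normalising \<open>A\<close> to the identity and applying Fischer's inequality
  blockwise\<close>

lemma sum_cdet_sq_split:
  assumes "T \<subseteq> {..<n}"
  shows "(\<Sum>f\<in>{..<n} \<rightarrow>\<^sub>E {..<n}. (cdet n (\<lambda>j. if j \<in> T then z j (f j) else basis_vec (f j)))\<^sup>2) =
    fact (n - card T) * (\<Sum>f\<in>T \<rightarrow>\<^sub>E {..<n}. wedge_sq n T (\<lambda>j. z j (f j)))"
proof -
  have split: "{..<n} = T \<union> ({..<n} - T)" using assms by auto
  have "(\<lambda>j. if j \<in> T then z j (if j \<in> T then f j else g j) else basis_vec (if j \<in> T then f j else g j)) =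
     (\<lambda>j. if j \<in> T then z j (f j) else basis_vec (g j))" for f g :: "nat \<Rightarrow> nat"
    by auto
  then have "(\<Sum>f\<in>(T \<union> ({..<n} - T)) \<rightarrow>\<^sub>E {..<n}. (cdet n (\<lambda>j. if j \<in> T then z j (f j) else basis_vec (f j)))\<^sup>2) =
    (\<Sum>f\<in>T \<rightarrow>\<^sub>E {..<n}. \<Sum>g\<in>({..<n} - T) \<rightarrow>\<^sub>E {..<n}. (cdet n (\<lambda>j. if j \<in> T then z j (f j) else basis_vec (g j)))\<^sup>2)"
    by (subst sum_PiE_Un_disjoint) auto
  moreover have "(\<Sum>g\<in>({..<n} - T) \<rightarrow>\<^sub>E {..<n}. (cdet n (\<lambda>j. if j \<in> T then z j (f j) else basis_vec (g j)))\<^sup>2) =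
      fact (n - card T) * wedge_sq n T (\<lambda>j. z j (f j))" for f
    by (simp add: wedge_sq_def)
  ultimately show ?thesis by (simp only: split[symmetric] sum_distrib_left)
qed

text \<open>A Gram representation relative to \<open>L\<close>; the matrix \<open>L * L\<^sup>T\<close> itself is represented by the standard basis.\<close>

definition gram_via :: "nat \<Rightarrow> real mat \<Rightarrow> real mat \<Rightarrow> (nat \<Rightarrow> nat \<Rightarrow> real) \<Rightarrow> bool" where
  "gram_via n L C z \<longleftrightarrow> C \<in> carrier_mat n n \<and> (\<forall>r<n. \<forall>c<n. C $$ (r, c) =
     (\<Sum>a<n. (\<Sum>s<n. L $$ (r, s) * z a s) * (\<Sum>s<n. L $$ (c, s) * z a s)))"

text \<open>The Gram vectors are images under \<open>L\<close>, so every determinant in the sum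
  carries the factor \<open>det L\<close>.\<close>

lemma mixed_discriminant_gram_via:
  assumes "L \<in> carrier_mat n n" "\<And>k. k < n \<Longrightarrow> gram_via n L (Cs ! k) (z k)"
  shows "fact n * mixed_discriminant n Cs =
    (det L)\<^sup>2 * (\<Sum>f\<in>{..<n} \<rightarrow>\<^sub>E {..<n}. (cdet n (\<lambda>k. z k (f k)))\<^sup>2)"
proof -
  have "fact n * mixed_discriminant n Cs =
    (\<Sum>f\<in>{..<n} \<rightarrow>\<^sub>E {..<n}. (cdet n (\<lambda>k r. \<Sum>s<n. L $$ (r, s) * z k (f k) s))\<^sup>2)"
    by (rule mixed_discriminant_gram[where y = "\<lambda>k a r. \<Sum>s<n. L $$ (r, s) * z k a s"])
      (use assms(2) in \<open>auto simp: gram_via_def\<close>)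
  then show ?thesis by (simp add: cdet_matrix_mult[OF assms(1)] power_mult_distrib sum_distrib_left)
qed

text \<open>The columns of \<open>L\<close> are Gram vectors of \<open>A\<close>, so
  \<open>A\<close> is \<open>L\<close> times its transpose and \<open>L\<close> is invertible. Gram
  vectors of any other \<open>C\<close> are then pulled back through the inverse of
  \<open>L\<close>.\<close>

lemma gram_via_exists:
  assumes A: "symmetric_psd n A" and "det A \<noteq> 0"
  obtains L where "L \<in> carrier_mat n n" "det A = (det L)\<^sup>2" "gram_via n L A basis_vec"
    and "\<And>C. symmetric_psd n C \<Longrightarrow> \<exists>z. gram_via n L C z"
proof -
  have AC: "A \<in> carrier_mat n n" using A by (simp add: symmetric_psd_def)
  obtain y where y: "\<And>r c. r < n \<Longrightarrow> c < n \<Longrightarrow> A $$ (r, c) = (\<Sum>l<n. y l r * y l c)"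
    using symmetric_psd_gram[OF A] by blast
  define L where "L = mat n n (\<lambda>(r, l). y l r)"
  have L: "L \<in> carrier_mat n n" by (simp add: L_def)
  have "A = L * L\<^sup>T"
    by (rule eq_matI) (use AC in \<open>auto simp: L_def y scalar_prod_def atLeast0LessThan\<close>)
  then have dA: "det A = (det L)\<^sup>2"
    using L by (simp add: det_mult[OF L] det_transpose[OF L] power2_eq_square)
  have "gram_via n L A basis_vec"
    using AC by (simp add: gram_via_def y L_def basis_vec_def)
  moreover have "\<exists>z. gram_via n L C z" if C: "symmetric_psd n C" for C
  proof -
    obtain w where w: "\<And>r c. r < n \<Longrightarrow> c < n \<Longrightarrow> C $$ (r, c) = (\<Sum>l<n. w l r * w l c)"
      using symmetric_psd_gram[OF C] by blast
    \<comment> \<open>This is the inverse of \<open>L\<close> applied to \<open>w a\<close>, with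
      the inverse written as adjugate over determinant.\<close>
    define z where "z a s = (\<Sum>t<n. adj_mat L $$ (s, t) * w a t) / det L" for a s
    have "(\<Sum>s<n. L $$ (r, s) * z a s) = w a r" if r: "r < n" for a r
    proof -
      have inv: "(\<Sum>s<n. L $$ (r, s) * adj_mat L $$ (s, t)) = (if t = r then det L else 0)" if "t < n" for t
      proof -
        have "(\<Sum>s<n. L $$ (r, s) * adj_mat L $$ (s, t)) = (L * adj_mat L) $$ (r, t)"
          using r that L adj_mat(1)[OF L] by (simp add: scalar_prod_def atLeast0LessThan)
        also have "\<dots> = (if t = r then det L else 0)"
          using r that by (simp add: adj_mat(2)[OF L])
        finally show ?thesis .
      qed
      have "det L * z a s = (\<Sum>t<n. adj_mat L $$ (s, t) * w a t)" for s
        using assms(2) dA by (simp add: z_def)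
      then have "det L * (\<Sum>s<n. L $$ (r, s) * z a s) = (\<Sum>s<n. \<Sum>t<n. L $$ (r, s) * adj_mat L $$ (s, t) * w a t)"
        by (simp add: sum_distrib_left mult.assoc mult.left_commute[of "det L"])
      also have "\<dots> = (\<Sum>t<n. (\<Sum>s<n. L $$ (r, s) * adj_mat L $$ (s, t)) * w a t)"
        unfolding sum_distrib_right by (rule sum.swap)
      also have "\<dots> = det L * w a r"
        using r by (simp add: inv if_distrib[of "\<lambda>x. x * _"] cong: if_cong)
      finally show ?thesis using assms(2) dA by simp
    qed
    then have "gram_via n L C z"
      using C by (simp add: gram_via_def symmetric_psd_def w)
    then show ?thesis by blast
  qed
  ultimately show ?thesis using that L dA by blast
qed

text \<open>The inequality for an arbitrary partition of the positions into blocks. In the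
  normalised coordinates each block factor is \<open>det A\<close> times a sum of
  \<open>wedge_sq\<close> values, so Fischer's inequality applies to each choice of Gram vectors,
  and the sum of the bounds factors over the blocks.\<close>

lemma mixed_discriminant_partition_le:
  assumes A: "symmetric_psd n A" and C: "\<And>j. j < n \<Longrightarrow> symmetric_psd n (C j)"
    and K: "finite K" "disjoint_family_on T K" "(\<Union>k\<in>K. T k) = {..<n}"
    and nz: "det A \<noteq> 0"
  shows "det A ^ card K * (fact n * mixed_discriminant n (map C [0..<n])) \<le>
    det A * (\<Prod>k\<in>K. fact n / fact (n - card (T k)) *
       mixed_discriminant n (map (\<lambda>j. if j \<in> T k then C j else A) [0..<n]))"
proof -
  obtain L where L: "L \<in> carrier_mat n n" "det A = (det L)\<^sup>2" "gram_via n L A basis_vec"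
    and ex: "\<And>C. symmetric_psd n C \<Longrightarrow> \<exists>z. gram_via n L C z"
    using gram_via_exists[OF A nz] by blast
  have "\<forall>j<n. \<exists>z. gram_via n L (C j) z" using ex C by blast
  then obtain z where z: "\<And>j. j < n \<Longrightarrow> gram_via n L (C j) (z j)" by metis
  let ?E = "{..<n}"
  let ?W = "\<lambda>k f. wedge_sq n (T k) (\<lambda>j. z j (f j))"
  have sub: "T k \<subseteq> {..<n}" if "k \<in> K" for k using K(3) that by auto
  have block: "fact n / fact (n - card (T k)) *
       mixed_discriminant n (map (\<lambda>j. if j \<in> T k then C j else A) [0..<n]) =
       det A * (\<Sum>f\<in>T k \<rightarrow>\<^sub>E ?E. ?W k f)" if k: "k \<in> K" for k
  proof -
    have "fact n * mixed_discriminant n (map (\<lambda>j. if j \<in> T k then C j else A) [0..<n]) =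
      det A * (\<Sum>f\<in>?E \<rightarrow>\<^sub>E ?E. (cdet n (\<lambda>j. (if j \<in> T k then z j else basis_vec) (f j)))\<^sup>2)"
      unfolding L(2) by (rule mixed_discriminant_gram_via[OF L(1)]) (use L(3) z in auto)
    moreover have "(\<lambda>j. (if j \<in> T k then z j else basis_vec) (f j)) =
        (\<lambda>j. if j \<in> T k then z j (f j) else basis_vec (f j))" for f :: "nat \<Rightarrow> nat" by auto
    ultimately have "fact n * mixed_discriminant n (map (\<lambda>j. if j \<in> T k then C j else A) [0..<n]) =
      det A * (fact (n - card (T k)) * (\<Sum>f\<in>T k \<rightarrow>\<^sub>E ?E. ?W k f))"
      by (simp only: sum_cdet_sq_split[OF sub[OF k]])
    then show ?thesis by (simp add: field_simps)
  qed
  have "fact n * mixed_discriminant n (map C [0..<n]) =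
      det A * (\<Sum>f\<in>?E \<rightarrow>\<^sub>E ?E. (cdet n (\<lambda>j. z j (f j)))\<^sup>2)"
    unfolding L(2) by (rule mixed_discriminant_gram_via[OF L(1)]) (use z in auto)
  also have "\<dots> \<le> det A * (\<Sum>f\<in>?E \<rightarrow>\<^sub>E ?E. \<Prod>k\<in>K. ?W k f)"
  proof (intro mult_left_mono sum_mono)
    show "(cdet n (\<lambda>j. z j (f j)))\<^sup>2 \<le> (\<Prod>k\<in>K. ?W k f)" for f
      using wedge_sq_Union_le[OF K(1,2) sub, of "\<lambda>j. z j (f j)"]
      by (simp only: K(3) wedge_sq_full)
  qed (simp add: L(2))
  also have "(\<Sum>f\<in>?E \<rightarrow>\<^sub>E ?E. \<Prod>k\<in>K. ?W k f) = (\<Prod>k\<in>K. \<Sum>f\<in>T k \<rightarrow>\<^sub>E ?E. ?W k f)"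
    unfolding K(3)[symmetric]
  proof (rule sum_PiE_Union_disjoint[OF K(1,2)])
    show "?W k f = ?W k g" if "\<And>j. j \<in> T k \<Longrightarrow> f j = g j" for k f g
      by (rule wedge_sq_cong) (simp add: that)
  qed
  \<comment> \<open>The prefactor \<open>det A ^ card K\<close> supplies one factor
    \<open>det A\<close> to each block; the remaining \<open>det A\<close> comes from the left-hand
    mixed discriminant.\<close>
  finally have "det A ^ card K * (fact n * mixed_discriminant n (map C [0..<n])) \<le>
    det A ^ card K * (det A * (\<Prod>k\<in>K. \<Sum>f\<in>T k \<rightarrow>\<^sub>E ?E. ?W k f))"
    by (rule mult_left_mono) (simp add: L(2))
  also have "\<dots> = det A * (\<Prod>k\<in>K. det A * (\<Sum>f\<in>T k \<rightarrow>\<^sub>E ?E. ?W k f))"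
    by (simp add: prod.distrib)
  finally show ?thesis by (simp only: block cong: prod.cong)
qed

section \<open>Block labels, multiplicities and the deduction of the theorem\<close>

lemma mset_map_if_eq:
  "mset (map (\<lambda>l. if l = k then b else a) xs) =
    mset (replicate (count_list xs k) b @ replicate (length xs - count_list xs k) a)"
proof (induction xs)
  case (Cons x xs)
  then show ?case using count_le_length[of xs k] by (simp add: Suc_diff_le)
qed simp

lemma count_list_concat_replicate:
  "count_list (concat (map (\<lambda>k. replicate (i k) k) [1..<m + 1])) k = (if k \<in> {1..m} then i k else 0)"
proof (induction m)
  case (Suc m)
  have "count_list (replicate n x) k = (if x = k then n else 0)" for n and x :: nat
    by (induction n) auto
  with Suc show ?case by auto
qed simp

lemma length_concat_replicate:
  "length (concat (map (\<lambda>k. replicate (i k) (f k)) [1..<m + 1])) = (\<Sum>k = 1..m. i k)"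
  by (induction m) auto

theorem theorem1:
  fixes m n s :: nat and i :: "nat \<Rightarrow> nat"
    and A :: "real mat" and B M :: "nat \<Rightarrow> real mat"
  assumes "m \<ge> 1" and "n \<ge> 2"
    and "s = (\<Sum>k = 1..m. i k)" and "s \<le> n"
    and "symmetric_psd n A"
    and "\<And>k. k \<in> {1..m} \<Longrightarrow> symmetric_psd n (B k)"
    and "\<And>j. j \<in> {1..n - s} \<Longrightarrow> symmetric_psd n (M j)"
  shows "fact n / ((\<Prod>k = 1..m. fact (i k)) * fact (n - s)) * det A ^ m *
           mixed_discriminant n
             (concat (map (\<lambda>k. replicate (i k) (B k)) [1..<m + 1]) @ map M [1..<n - s + 1])
       \<le> real (n choose s) * mixed_discriminant n (map M [1..<n - s + 1] @ replicate s A) *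
           (\<Prod>k = 1..m. real (n choose i k) *
              mixed_discriminant n (replicate (i k) (B k) @ replicate (n - i k) A))"
proof -
  let ?Bs = "concat (map (\<lambda>k. replicate (i k) (B k)) [1..<m + 1])"
  let ?Ms = "map M [1..<n - s + 1]"
  let ?D = "mixed_discriminant n"
  let ?DM = "?D (?Ms @ replicate s A)" and ?Dk = "\<lambda>k. ?D (replicate (i k) (B k) @ replicate (n - i k) A)"
  have lenB: "length ?Bs = s" using length_concat_replicate[of i B m] assms(3) by simp
  have ik: "i k \<le> n" if "k \<in> {1..m}" for k
    using member_le_sum[of k "{1..m}" i] that assms(3,4) by simp
  have D0: "0 \<le> ?DM"
    by (rule mixed_discriminant_psd_nonneg) (use assms(4,5,7) in auto)
  have Dk: "0 \<le> ?Dk k" if "k \<in> {1..m}" for k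
    by (rule mixed_discriminant_psd_nonneg) (use assms(5,6) that ik in auto)
  show ?thesis
  proof (cases "det A = 0")
    case True
    \<comment> \<open>Here \<open>m \<ge> 1\<close> matters, since a zeroth power would be
      1.\<close>
    then have "det A ^ m = 0" using assms(1) by simp
    moreover have "0 \<le> (\<Prod>k = 1..m. real (n choose i k) * ?Dk k)"
      by (intro prod_nonneg mult_nonneg_nonneg ballI Dk) auto
    ultimately show ?thesis using D0
      by (simp only: mult_zero_right mult_zero_left mult_nonneg_nonneg of_nat_0_le_iff)
  next
    case False
    \<comment> \<open>Each position is labelled by its block: \<open>k\<close> for the copies of
      \<open>B k\<close>, and 0 for the matrices \<open>M\<close>. This gives \<open>m + 1\<close>
      blocks, some possibly empty.\<close>
    define lab1 where "lab1 = concat (map (\<lambda>k. replicate (i k) k) [1..<m + 1])"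
    define lab where "lab = lab1 @ replicate (n - s) 0"
    define T where "T k = {j. j < n \<and> lab ! j = k}" for k
    define C where "C j = (?Bs @ ?Ms) ! j" for j
    have len1: "length lab1 = s"
      using length_concat_replicate[of i id m] assms(3) by (simp add: lab1_def)
    have len: "length lab = n" using len1 assms(4) by (simp add: lab_def)
    have set1: "set lab1 \<subseteq> {1..m}" by (auto simp: lab1_def)
    have lab_lt: "lab ! j \<in> {1..m}" if "j < s" for j
    proof -
      have "lab1 ! j \<in> set lab1" using that len1 by simp
      then show ?thesis using that set1 len1 by (simp add: lab_def nth_append subset_iff)
    qed
    have lab_ge: "lab ! j = 0" if "s \<le> j" "j < n" for j
      using that len1 by (simp add: lab_def nth_append)
    have Bs: "?Bs = map B lab1" by (simp add: lab1_def map_concat o_def)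
    have C_lt: "C j = B (lab ! j)" if "j < s" for j
      using that len1 unfolding C_def Bs by (simp add: lab_def nth_append)
    \<comment> \<open>Positions are counted from 0 but the matrices \<open>M\<close> from 1, so
      position \<open>s\<close> holds \<open>M 1\<close>.\<close>
    have C_ge: "C j = M (j - s + 1)" if "s \<le> j" "j < n" for j
      using that lenB by (simp add: C_def nth_append add.commute del: upt_Suc)
    have mapC: "map C [0..<n] = ?Bs @ ?Ms"
      by (rule nth_equalityI) (use lenB assms(4) in \<open>auto simp: C_def\<close>)
    have psdC: "symmetric_psd n (C j)" if "j < n" for j
      using that C_lt C_ge lab_lt assms(6,7) by (cases "j < s") auto
    have count: "count_list lab k = (if k = 0 then n - s else i k)" if "k \<le> m" for k
    proof -
      have "count_list (replicate (n - s) (0::nat)) k = (if k = 0 then n - s else 0)"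
        by (induction "n - s") (auto simp: count_list_eq_length_filter)
      moreover have "count_list lab1 k = (if k \<in> {1..m} then i k else 0)"
        unfolding lab1_def by (rule count_list_concat_replicate)
      ultimately show ?thesis using that by (simp add: lab_def)
    qed
    have cardT: "card (T k) = (if k = 0 then n - s else i k)" if "k \<le> m" for k
    proof -
      have "T k = {j. j < length lab \<and> k = lab ! j}" using len by (auto simp: T_def)
      then show ?thesis
        using count[OF that] by (simp add: count_list_eq_length_filter length_filter_conv_card)
    qed
    have UT: "(\<Union>k\<in>{0..m}. T k) = {..<n}"
    proof -
      have "lab ! j \<le> m" if "j < n" for j
        using lab_lt[of j] lab_ge[of j] that by (cases "j < s") auto
      then show ?thesis by (auto simp: T_def)
    qed
    have disj: "disjoint_family_on T {0..m}" by (auto simp: disjoint_family_on_def T_def)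
    let ?E = "\<lambda>k. ?D (map (\<lambda>j. if j \<in> T k then C j else A) [0..<n])"
    have E0: "?E 0 = ?DM"
    proof (rule mixed_discriminant_mset)
      have "map (\<lambda>j. if j \<in> T 0 then C j else A) [0..<n] = replicate s A @ ?Ms"
      proof (rule nth_equalityI)
        fix j assume "j < length (map (\<lambda>j. if j \<in> T 0 then C j else A) [0..<n])"
        then show "map (\<lambda>j. if j \<in> T 0 then C j else A) [0..<n] ! j = (replicate s A @ ?Ms) ! j"
          using lab_lt[of j] lab_ge[of j] C_ge[of j] by (cases "j < s") (auto simp: T_def nth_append simp del: upt_Suc)
      qed (use assms(4) in \<open>simp del: upt_Suc\<close>)
      then show "mset (map (\<lambda>j. if j \<in> T 0 then C j else A) [0..<n]) = mset (?Ms @ replicate s A)"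
        by simp
    qed (use assms(4) in \<open>simp del: upt_Suc\<close>)
    have Ek: "?E k = ?Dk k" if k: "k \<in> {1..m}" for k
    proof (rule mixed_discriminant_mset)
      have "map (\<lambda>j. if j \<in> T k then C j else A) [0..<n] = map (\<lambda>l. if l = k then B k else A) lab"
      proof (rule nth_equalityI)
        fix j assume "j < length (map (\<lambda>j. if j \<in> T k then C j else A) [0..<n])"
        then show "map (\<lambda>j. if j \<in> T k then C j else A) [0..<n] ! j = map (\<lambda>l. if l = k then B k else A) lab ! j"
          using lab_ge[of j] C_lt[of j] k len by (cases "j < s") (auto simp: T_def)
      qed (use len in simp)
      then show "mset (map (\<lambda>j. if j \<in> T k then C j else A) [0..<n]) =
          mset (replicate (i k) (B k) @ replicate (n - i k) A)"
        using k count[of k] len by (simp only: mset_map_if_eq) auto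
    qed (use ik[OF k] in simp)
    obtain L where "det A = (det L)\<^sup>2"
      using gram_via_exists[OF assms(5) False] by blast
    then have pos: "0 < det A" using False by simp
    let ?P = "\<Prod>k = 1..m. fact n / fact (n - i k) * ?Dk k"
    have set0: "{0..m} = insert 0 {1..m}" by auto
    \<comment> \<open>With \<open>m + 1\<close> blocks the left side has exponent
      \<open>m + 1\<close>; cancelling the positive \<open>det A\<close> on both sides leaves the
      required \<open>m\<close>.\<close>
    have "det A ^ card {0..m} * (fact n * ?D (?Bs @ ?Ms)) \<le>
      det A * (\<Prod>k\<in>{0..m}. fact n / fact (n - card (T k)) * ?E k)"
      unfolding mapC[symmetric]
      by (rule mixed_discriminant_partition_le[OF assms(5) _ finite_atLeastAtMost disj UT False]) (rule psdC)
    \<comment> \<open>Block 0 has \<open>n - s\<close> positions, so its denominator is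
      \<open>fact s\<close>.\<close>
    also have "(\<Prod>k\<in>{0..m}. fact n / fact (n - card (T k)) * ?E k) = (fact n / fact s * ?DM) * ?P"
    proof -
      have "(\<Prod>k = 1..m. fact n / fact (n - card (T k)) * ?E k) = ?P"
        by (rule prod.cong) (auto simp: Ek cardT)
      then show ?thesis using assms(4) E0 by (simp add: set0 cardT)
    qed
    finally have "det A * (det A ^ m * (fact n * ?D (?Bs @ ?Ms))) \<le> det A * ((fact n / fact s * ?DM) * ?P)"
      by (simp only: card_atLeastAtMost diff_zero power_Suc mult.assoc)
    then have main: "det A ^ m * (fact n * ?D (?Bs @ ?Ms)) \<le> (fact n / fact s * ?DM) * ?P"
      using pos by (rule mult_left_le_imp_le)
    \<comment> \<open>Dividing by \<open>?c\<close> gives each block the factorial of its size,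
      which completes its coefficient to a binomial.\<close>
    let ?c = "(\<Prod>k = 1..m. fact (i k)) * fact (n - s) :: real"
    have "fact n / ?c * det A ^ m * ?D (?Bs @ ?Ms) = (det A ^ m * (fact n * ?D (?Bs @ ?Ms))) / ?c"
      by simp
    also have "\<dots> \<le> ((fact n / fact s * ?DM) * ?P) / ?c"
      by (rule divide_right_mono[OF main]) (simp add: prod_nonneg)
    also have "\<dots> = (fact n / (fact s * fact (n - s)) * ?DM) * (?P / (\<Prod>k = 1..m. fact (i k)))"
      by (simp add: field_simps)
    also have "?P / (\<Prod>k = 1..m. fact (i k)) = (\<Prod>k = 1..m. real (n choose i k) * ?Dk k)"
      unfolding prod_dividef[symmetric]
      by (rule prod.cong) (auto simp: binomial_fact ik)
    also have "fact n / (fact s * fact (n - s)) = real (n choose s)"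
      using assms(4) by (simp add: binomial_fact)
    finally show ?thesis .
  qed
qed

end
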